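(* Let $(H;\langle\cdot,\cdot\rangle)$ be an inner product space over $\mathbb{K}$ and $x,y,e\in H$ with $\|e\|=1$. If $r_1,r_2>0$ and $$\|x-e\|\le r_1,\qquad \|y-e\|\le r_2,$$ then $$|\langle x,y\rangle-\langle x,e\rangle\langle e,y\rangle|\le r_1r_2\sqrt{\tfrac14 r_1^2+|\langle x,e\rangle|}\cdot\sqrt{\tfrac14 r_2^2+|\langle y,e\rangle|} .$$
   Context: $\mathbb{K}$ denotes $\mathbb{R}$ or $\mathbb{C}$. Inner products are linear in the first argument and conjugate-linear in the second, and $\|x\|=\langle x,x\rangle^{1/2}$. *)

theory Defs
  imports "HOL-Analysis.Inner_Product"
begin

text \<open>
  Real inner product spaces are the library class \<^class>\<open>real_inner\<close>. The library has no
  complex counterpart, so it is introduced here as a locale over \<^locale>\<open>vector_space\<close>.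
  The inner product is linear in the first and conjugate-linear in the second argument.
\<close>

locale complex_inner_space = vector_space scale
  for scale :: "complex \<Rightarrow> 'h::ab_group_add \<Rightarrow> 'h" +
  fixes ip :: "'h \<Rightarrow> 'h \<Rightarrow> complex"
  assumes ip_add_left: "ip (x + y) z = ip x z + ip y z"
    and ip_scale_left: "ip (scale c x) y = c * ip x y"
    and ip_cnj_commute: "ip y x = cnj (ip x y)"
    and ip_nonneg: "0 \<le> Re (ip x x)"
    and ip_eq_zero_iff: "ip x x = 0 \<longleftrightarrow> x = 0"
begin

text \<open>By \<open>ip_cnj_commute\<close>, \<open>ip x x\<close> is real.\<close>

definition ip_norm :: "'h \<Rightarrow> real"
  where "ip_norm x = sqrt (Re (ip x x))"

lemma ip_self: "ip x x = complex_of_real ((ip_norm x)\<^sup>2)"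
proof -
  have "Im (ip x x) = 0"
    using arg_cong[OF ip_cnj_commute[of x x], of Im] by simp
  then show ?thesis
    using ip_nonneg[of x] by (simp add: complex_eq_iff ip_norm_def)
qed

end

lemma complex_inner_space_complex:
  "complex_inner_space (*) (\<lambda>x y :: complex. x * cnj y)"
  by unfold_locales (auto simp: algebra_simps)

end

theory Submission imports Defs begin

text \<open>
  Apply the Cauchy-Schwarz inequality to the components of \<open>x\<close> and \<open>y\<close> orthogonal to \<open>e\<close>. With
  \<open>A = |\<langle>x,e\<rangle>|\<close> and \<open>r = r\<^sub>1\<close>, the component of \<open>x\<close> satisfies
  \<open>\<parallel>x\<parallel>\<^sup>2 - A\<^sup>2 \<le> r\<^sup>2 - (1 - A)\<^sup>2 = r\<^sup>2 (r\<^sup>2/4 + A) - (r\<^sup>2/2 - (1 - A))\<^sup>2\<close>, and likewise for \<open>y\<close>.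
\<close>

lemma orthogonal_part_bound:
  fixes P R A r :: real
  assumes "P - 2 * R + 1 \<le> r\<^sup>2" and "R \<le> A"
  shows "P - A\<^sup>2 \<le> r\<^sup>2 * (1/4 * r\<^sup>2 + A)"
proof -
  have "0 \<le> (r\<^sup>2/2 - (1 - A))\<^sup>2" by simp
  also have "\<dots> = r\<^sup>2 * (1/4 * r\<^sup>2 + A) - (r\<^sup>2 - 1 + 2 * A - A\<^sup>2)"
    by (simp add: power2_eq_square field_simps)
  \<comment> \<open>Replacing \<open>R\<close> by the larger \<open>A\<close> weakens
    \<open>P \<le> r\<^sup>2 - 1 + 2 * R\<close> to the form needed here.\<close>
  finally show ?thesis using assms by linarith
qed

text \<open>The scalar core shared by the real and the complex case. \<open>P\<close>,
  \<open>R\<close>, \<open>A\<close> stand for the squared norm of x, Re <x,e> and |<x,e>|;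
  \<open>Q\<close>, \<open>S\<close>, \<open>B\<close> are the same for y, and \<open>g\<close> is
  the left-hand side of the claim.\<close>

lemma gruess_from_Cauchy_Schwarz:
  fixes g P Q A B R S r s :: real
  assumes g: "g\<^sup>2 \<le> (P - A\<^sup>2) * (Q - B\<^sup>2)"
    and "0 \<le> P - A\<^sup>2" "0 \<le> Q - B\<^sup>2"
    and P: "P - 2 * R + 1 \<le> r\<^sup>2" "R \<le> A"
    and Q: "Q - 2 * S + 1 \<le> s\<^sup>2" "S \<le> B"
    and "0 \<le> A" "0 \<le> B" "0 \<le> r" "0 \<le> s"
  shows "g \<le> r * s * sqrt (1/4 * r\<^sup>2 + A) * sqrt (1/4 * s\<^sup>2 + B)"
proof (rule power2_le_imp_le)
  have "g\<^sup>2 \<le> (r\<^sup>2 * (1/4 * r\<^sup>2 + A)) * (s\<^sup>2 * (1/4 * s\<^sup>2 + B))"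
    \<comment> \<open>Multiplying the two upper bounds is legitimate because the bounded factors are
      nonnegative.\<close>
    using g mult_mono'[OF orthogonal_part_bound[OF P] orthogonal_part_bound[OF Q]] assms(2,3)
    by linarith
  also have "\<dots> = (r * s * sqrt (1/4 * r\<^sup>2 + A) * sqrt (1/4 * s\<^sup>2 + B))\<^sup>2"
    using assms by (simp add: power_mult_distrib)
  finally show "g\<^sup>2 \<le> (r * s * sqrt (1/4 * r\<^sup>2 + A) * sqrt (1/4 * s\<^sup>2 + B))\<^sup>2" .
qed (use assms in simp)

lemma gruess_real:
  fixes x y e :: "'a::real_inner"
  assumes "norm e = 1" "norm (x - e) \<le> r" "norm (y - e) \<le> s"
  shows "\<bar>inner x y - inner x e * inner e y\<bar>
    \<le> r * s * sqrt (1/4 * r\<^sup>2 + \<bar>inner x e\<bar>) * sqrt (1/4 * s\<^sup>2 + \<bar>inner y e\<bar>)"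
proof -
  have ee: "inner e e = 1" using assms(1) by (simp add: norm_eq_1)
  \<comment> \<open>Projection onto the orthogonal complement of the unit vector \<open>e\<close>;
    the expression to be estimated is the inner product of the projections of \<open>x\<close> and
    \<open>y\<close>.\<close>
  let ?p = "\<lambda>z. z - inner z e *\<^sub>R e"
  have orth: "inner (?p z) (?p w) = inner z w - inner z e * inner e w" for z w
    using ee by (simp add: inner_diff_left inner_diff_right inner_commute[of w e])
  have self: "inner (?p z) (?p z) = inner z z - \<bar>inner z e\<bar>\<^sup>2" for z
    by (simp add: orth power2_eq_square inner_commute[of e z])
  have dist: "inner z z - 2 * inner z e + 1 \<le> t\<^sup>2" if "norm (z - e) \<le> t" for z t
  proof -
    have "inner z z - 2 * inner z e + 1 = (norm (z - e))\<^sup>2"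
      by (simp add: power2_norm_eq_inner inner_diff_left inner_diff_right ee inner_commute[of e z])
    also have "\<dots> \<le> t\<^sup>2" using that by (simp add: power_mono)
    finally show ?thesis .
  qed
  have pos: "0 \<le> inner z z - \<bar>inner z e\<bar>\<^sup>2" for z
    using self[of z] inner_ge_zero[of "?p z"] by linarith
  have "\<bar>inner x y - inner x e * inner e y\<bar>\<^sup>2
      \<le> (inner x x - \<bar>inner x e\<bar>\<^sup>2) * (inner y y - \<bar>inner y e\<bar>\<^sup>2)"
    using Cauchy_Schwarz_ineq[of "?p x" "?p y"] by (simp only: self orth power2_abs)
  moreover have "0 \<le> r" "0 \<le> s" using assms(2,3) norm_ge_zero order_trans by blast+
  ultimately show ?thesis
    by (intro gruess_from_Cauchy_Schwarz[OF _ pos pos dist abs_ge_self dist abs_ge_self])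
      (use assms in auto)
qed

context complex_inner_space
begin

lemma ip_diff_left: "ip (x - y) z = ip x z - ip y z"
  using ip_add_left[of "x - y" y z] by simp

lemma ip_diff_right: "ip x (y - z) = ip x y - ip x z"
  using ip_cnj_commute[of x "y - z"] ip_cnj_commute[of x y] ip_cnj_commute[of x z]
  by (simp add: ip_diff_left)

lemma ip_scale_right: "ip x (scale c y) = cnj c * ip x y"
  using ip_cnj_commute[of x "scale c y"] ip_cnj_commute[of x y] by (simp add: ip_scale_left)

lemma ip_norm_nonneg: "0 \<le> ip_norm x"
  using ip_nonneg by (simp add: ip_norm_def)

lemma ip_norm_power2: "(ip_norm x)\<^sup>2 = Re (ip x x)"
  using ip_nonneg by (simp add: ip_norm_def)

lemma ip_mult_commute: "ip x y * ip y x = complex_of_real ((cmod (ip x y))\<^sup>2)"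
  using complex_norm_square[of "ip x y"] ip_cnj_commute[of y x] by simp

lemma ip_Cauchy_Schwarz: "(cmod (ip u v))\<^sup>2 \<le> (ip_norm u)\<^sup>2 * (ip_norm v)\<^sup>2"
proof (cases "v = 0")
  case True
  \<comment> \<open>Writing 0 as 0 - 0 gives \<open>ip u 0 = 0\<close>.\<close>
  then show ?thesis using ip_diff_right[of u 0 0] by simp
next
  case False
  define V where "V = (ip_norm v)\<^sup>2"
  have "0 < V"
    using False ip_eq_zero_iff[of v] ip_self[of v] by (simp add: V_def)
  \<comment> \<open>\<open>V\<close> times the component of \<open>u\<close> orthogonal to
    \<open>v\<close>; the factor \<open>V\<close> avoids division. In \<open>ip ?w ?w\<close> two of
    the three terms containing \<open>ip u v * ip v u\<close> cancel.\<close>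
  let ?w = "scale (of_real V) u - scale (ip u v) v"
  have vv: "ip v v = of_real V" and uu: "ip u u = of_real ((ip_norm u)\<^sup>2)"
    by (simp_all only: ip_self V_def)
  have cc: "cnj (ip u v) = ip v u" using ip_cnj_commute[of v u] by simp
  have "ip ?w ?w = of_real V * (of_real V * ip u u) - of_real V * (ip u v * ip v u)"
    by (simp add: ip_diff_left ip_diff_right ip_scale_left ip_scale_right vv cc algebra_simps)
  also have "\<dots> = complex_of_real (V * ((ip_norm u)\<^sup>2 * V - (cmod (ip u v))\<^sup>2))"
    by (simp add: ip_mult_commute uu algebra_simps)
  finally have "0 \<le> V * ((ip_norm u)\<^sup>2 * V - (cmod (ip u v))\<^sup>2)"
    using ip_nonneg[of ?w] by (simp only: Re_complex_of_real)
  then show ?thesis using \<open>0 < V\<close> by (simp add: zero_le_mult_iff V_def)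
qed

lemma gruess_complex:
  assumes "ip_norm e = 1" "ip_norm (x - e) \<le> r" "ip_norm (y - e) \<le> s"
  shows "cmod (ip x y - ip x e * ip e y)
    \<le> r * s * sqrt (1/4 * r\<^sup>2 + cmod (ip x e)) * sqrt (1/4 * s\<^sup>2 + cmod (ip y e))"
proof -
  have ee: "ip e e = 1" using assms(1) ip_self[of e] by simp
  let ?p = "\<lambda>z. z - scale (ip z e) e"
  have orth: "ip (?p z) (?p w) = ip z w - ip z e * ip e w" for z w
    using ee ip_cnj_commute[of w e]
    by (simp add: ip_diff_left ip_diff_right ip_scale_left ip_scale_right)
  have self: "(ip_norm (?p z))\<^sup>2 = (ip_norm z)\<^sup>2 - (cmod (ip z e))\<^sup>2" for z
    unfolding ip_norm_power2 orth ip_mult_commute by simp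
  \<comment> \<open>The cross terms \<open>ip z e\<close> and \<open>ip e z\<close> are conjugate,
    so only the real part appears; it is later bounded by the modulus.\<close>
  have dist: "(ip_norm z)\<^sup>2 - 2 * Re (ip z e) + 1 \<le> t\<^sup>2" if "ip_norm (z - e) \<le> t" for z t
  proof -
    have "(ip_norm z)\<^sup>2 - 2 * Re (ip z e) + 1 = (ip_norm (z - e))\<^sup>2"
      unfolding ip_norm_power2 by (simp add: ip_diff_left ip_diff_right ee ip_cnj_commute[of e z])
    also have "\<dots> \<le> t\<^sup>2" using that by (simp add: power_mono ip_norm_nonneg)
    finally show ?thesis .
  qed
  have pos: "0 \<le> (ip_norm z)\<^sup>2 - (cmod (ip z e))\<^sup>2" for z
    by (metis self zero_le_power2)
  have "(cmod (ip x y - ip x e * ip e y))\<^sup>2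
      \<le> ((ip_norm x)\<^sup>2 - (cmod (ip x e))\<^sup>2) * ((ip_norm y)\<^sup>2 - (cmod (ip y e))\<^sup>2)"
    using ip_Cauchy_Schwarz[of "?p x" "?p y"] by (simp only: self orth)
  moreover have "0 \<le> r" "0 \<le> s" using assms(2,3) ip_norm_nonneg order_trans by blast+
  ultimately show ?thesis
    by (intro gruess_from_Cauchy_Schwarz[OF _ pos pos dist complex_Re_le_cmod dist complex_Re_le_cmod])
      (use assms in auto)
qed

end

text \<open>The conjuncts are the cases K = R and K = C. In the second, \<open>scale\<close> and
  \<open>ip\<close> are quantified explicitly because they are locale parameters.\<close>

theorem theorem4:
  fixes r\<^sub>1 r\<^sub>2 :: real
  assumes "r\<^sub>1 > 0" and "r\<^sub>2 > 0"
  shows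
    "(\<forall>x y e :: 'a::real_inner.
        norm e = 1 \<longrightarrow> norm (x - e) \<le> r\<^sub>1 \<longrightarrow> norm (y - e) \<le> r\<^sub>2 \<longrightarrow>
        \<bar>inner x y - inner x e * inner e y\<bar>
          \<le> r\<^sub>1 * r\<^sub>2 * sqrt (1/4 * r\<^sub>1\<^sup>2 + \<bar>inner x e\<bar>) * sqrt (1/4 * r\<^sub>2\<^sup>2 + \<bar>inner y e\<bar>))
     \<and>
     (\<forall>(scale :: complex \<Rightarrow> 'h::ab_group_add \<Rightarrow> 'h) ip. complex_inner_space scale ip \<longrightarrow>
        (\<forall>x y e :: 'h.
          complex_inner_space.ip_norm ip e = 1 \<longrightarrow>
          complex_inner_space.ip_norm ip (x - e) \<le> r\<^sub>1 \<longrightarrow>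
          complex_inner_space.ip_norm ip (y - e) \<le> r\<^sub>2 \<longrightarrow>
          cmod (ip x y - ip x e * ip e y)
            \<le> r\<^sub>1 * r\<^sub>2 * sqrt (1/4 * r\<^sub>1\<^sup>2 + cmod (ip x e)) * sqrt (1/4 * r\<^sub>2\<^sup>2 + cmod (ip y e))))"
  by (blast intro: gruess_real complex_inner_space.gruess_complex)

end
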